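(* Let $c>1$ be a constant and $p\in(0,1)$. Run the $\mathrm{GP}$ algorithm on $n$ processors $0,\ldots,n-1$ where processor $0$ is non-faulty and each processor $1,\ldots,n-1$ is faulty independently with probability $1-p$. Then, with probability at least $1-n\exp\left(-\frac{(c-1)^2}{2c}\left(\lceil\log(n-1)\rceil-1\right)\right)$, the execution time of the algorithm is at most $\frac{c}{p}\left(\lceil\log(n-1)\rceil+1\right)$.
   Context: $\log$ is to base 2. For a sequence $s=(s_1,s_2,\ldots)$, $\mathrm{ODD}(s)=(s_1,s_3,\ldots)$, $\mathrm{EVEN}(s)=(s_2,s_4,\ldots)$. The $\mathrm{GP}$ algorithm works in synchronous rounds. Initially processor $0$ holds the rumor and the list $(1,2,\ldots,n-1)$; all others hold empty lists. In each round, every processor $i$ holding a nonempty list $(j_1,\ldots,j_k)$ sends a communication request to $j_1$ and deletes $j_1$ from its list. Faulty processors never send messages and do not respond; a processor calling a faulty processor learns that the call failed, and then simply continues with its remaining list $(j_2,\ldots,j_k)$. If $j_1$ is non-faulty, $i$ sends it the rumor together with the list $\mathrm{EVEN}(j_2,\ldots,j_k)$, which becomes $j_1$'s list, and $i$ sets its own list to $\mathrm{ODD}(j_2,\ldots,j_k)$. The algorithm terminates when all processors hold empty lists; its execution time is the number of rounds until termination. *)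

theory Defs
  imports "HOL-Probability.Probability"
begin

fun odd_sublist :: "'a list \<Rightarrow> 'a list" and even_sublist :: "'a list \<Rightarrow> 'a list" where
  "odd_sublist [] = []"
| "odd_sublist (x # xs) = x # even_sublist xs"
| "even_sublist [] = []"
| "even_sublist (x # xs) = odd_sublist xs"

record gp_state =
  informed :: "nat set"
  tasks :: "nat \<Rightarrow> nat list"

definition gp_init :: "nat \<Rightarrow> gp_state" where
  "gp_init n = \<lparr>informed = {0}, tasks = (\<lambda>i. if i = 0 then [1..<n] else [])\<rparr>"

definition calls :: "(nat \<Rightarrow> bool) \<Rightarrow> gp_state \<Rightarrow> nat \<Rightarrow> nat \<Rightarrow> bool" where
  "calls F s i j \<longleftrightarrow> \<not> F i \<and> tasks s i \<noteq> [] \<and> hd (tasks s i) = j"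

text \<open>
  In a state reachable from the initial one, the lists of distinct processors are disjoint and no
  list mentions a processor that is already informed. Hence a processor has at most one caller
  per round (so the choice operator below makes no real choice) and a non-faulty processor that
  is called holds an empty list at that moment.
\<close>

definition gp_round :: "(nat \<Rightarrow> bool) \<Rightarrow> gp_state \<Rightarrow> gp_state" where
  "gp_round F s =
    \<lparr>informed = informed s \<union> {j. \<not> F j \<and> (\<exists>i. calls F s i j)},
     tasks = (\<lambda>j.
       if \<not> F j \<and> (\<exists>i. calls F s i j) then even_sublist (tl (tasks s (SOME i. calls F s i j)))
       else if \<not> F j \<and> tasks s j \<noteq> [] then
         (if F (hd (tasks s j)) then tl (tasks s j) else odd_sublist (tl (tasks s j)))
       else tasks s j)\<rparr>"

definition gp_state_after :: "nat \<Rightarrow> (nat \<Rightarrow> bool) \<Rightarrow> nat \<Rightarrow> gp_state" where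
  "gp_state_after n F t = (gp_round F ^^ t) (gp_init n)"

definition gp_terminated :: "nat \<Rightarrow> gp_state \<Rightarrow> bool" where
  "gp_terminated n s \<longleftrightarrow> (\<forall>i<n. tasks s i = [])"

definition gp_time :: "nat \<Rightarrow> (nat \<Rightarrow> bool) \<Rightarrow> nat" where
  "gp_time n F = (LEAST t. gp_terminated n (gp_state_after n F t))"

text \<open>
  The set over which the minimum in \<^const>\<open>gp_time\<close> is taken is never empty: every
  round shortens the longest list.
\<close>

lemma length_odd_even_sublist_le:
  "length (odd_sublist xs) \<le> length xs" "length (even_sublist xs) \<le> length xs"
  by (induction xs rule: odd_sublist_even_sublist.induct) auto

lemma length_tasks_gp_state_after:
  assumes "\<not> F 0"
  shows "length (tasks (gp_state_after n F t) i) \<le> n - 1 - t \<and>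
         (F i \<longrightarrow> tasks (gp_state_after n F t) i = [])"
proof (induction t arbitrary: i)
  case 0
  show ?case using assms by (auto simp: gp_state_after_def gp_init_def)
next
  case (Suc t)
  define s where "s = gp_state_after n F t"
  have step: "gp_state_after n F (Suc t) = gp_round F s"
    by (simp add: gp_state_after_def s_def)
  have len: "length (tasks s j) \<le> n - 1 - t" and faulty: "F j \<Longrightarrow> tasks s j = []" for j
    using Suc.IH by (simp_all add: s_def)
  have tl_len: "length (tl (tasks s j)) \<le> n - 1 - Suc t" for j
    using len[of j] by simp
  have "length (odd_sublist (tl (tasks s j))) \<le> n - 1 - Suc t"
    "length (even_sublist (tl (tasks s j))) \<le> n - 1 - Suc t" for j
    by (rule order_trans[OF length_odd_even_sublist_le(1) tl_len],
        rule order_trans[OF length_odd_even_sublist_le(2) tl_len])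
  then show ?case
    unfolding step using tl_len faulty by (auto simp: gp_round_def)
qed

lemma gp_terminates:
  assumes "\<not> F 0"
  shows "\<exists>t. gp_terminated n (gp_state_after n F t)"
  using length_tasks_gp_state_after[of F n n, OF assms] unfolding gp_terminated_def by auto

end

theory Submission
  imports Defs
begin

text \<open>
  Let $T(L)$ be the number of rounds needed to clear a list $L$ together with all lists split off
  from it. It satisfies $T(j, r) = 1 + T(r)$ if $j$ is faulty and
  $T(j, r) = 1 + \max(T(\mathrm{ODD}(r)), T(\mathrm{EVEN}(r)))$ otherwise, and the execution
  time is at most $T(1, \ldots, n - 1)$. Since the status of $j$ is independent of
  $T$ on sublists of $r$, a union bound over the two halves gives by induction on $t$
  \[ P(T(L) > t) \le |L| \, c^d \, (1 - p + p / c)^t \quad \mbox{if } |L| < 2^{d+1}. \]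
  The factor $1/c$ earned by a successful call comes from the halving of the list, which lowers
  $d$ by one; the two halves together are no longer than $L$. This amounts to the Chernoff bound
  for the lower tail of the number of successful calls on the way to a processor. Finally take
  $d = \lceil\log(n-1)\rceil$ and let $t$ be the integer part of $c (d + 1) / p$.
\<close>

section \<open>Lengths and entries of the two halves of a list\<close>

lemma length_odd_sublist: "length (odd_sublist xs) = (length xs + 1) div 2"
  and length_even_sublist: "length (even_sublist xs) = length xs div 2"
  by (induction xs rule: odd_sublist_even_sublist.induct) auto

lemma set_odd_sublist: "set (odd_sublist xs) \<subseteq> set xs"
  and set_even_sublist: "set (even_sublist xs) \<subseteq> set xs"
  by (induction xs rule: odd_sublist_even_sublist.induct) auto

lemma distinct_odd_even_sublist:
  "distinct xs \<Longrightarrow> distinct (odd_sublist xs) \<and> distinct (even_sublist xs)"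
  by (induction xs) (use set_odd_sublist set_even_sublist in force)+

section \<open>Clearing time of a list\<close>

text \<open>The maximum reflects that the caller and the called processor clear their halves in
  parallel.\<close>

function list_time :: "(nat \<Rightarrow> bool) \<Rightarrow> nat list \<Rightarrow> nat" where
  "list_time F [] = 0"
| "list_time F (j # js) = Suc (if F j then list_time F js
     else max (list_time F (odd_sublist js)) (list_time F (even_sublist js)))"
  by pat_completeness auto
termination
  by (relation "Wellfounded.measure (\<lambda>(F, xs). length xs)")
     (auto simp: length_odd_sublist length_even_sublist)

lemma list_time_eq_0_iff: "list_time F xs = 0 \<longleftrightarrow> xs = []"
  by (cases xs) auto

lemma list_time_cong: "(\<And>i. i \<in> set xs \<Longrightarrow> F i = G i) \<Longrightarrow> list_time F xs = list_time G xs"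
proof (induction F xs rule: list_time.induct)
  case (2 F j js)
  then have "F j = G j"
    by simp
  moreover have "list_time F js = list_time G js" if "F j"
    using 2 that by simp
  moreover have "list_time F (odd_sublist js) = list_time G (odd_sublist js)"
    "list_time F (even_sublist js) = list_time G (even_sublist js)" if "\<not> F j"
    using 2 that set_odd_sublist[of js] set_even_sublist[of js] by (auto simp: subset_iff)
  ultimately show ?case
    by simp
qed simp

text \<open>A list acted upon in a round is replaced by its tail or one of its halves, whose
  clearing time is smaller by at least one. Truncated subtraction covers lists that are already
  empty. As processor 0 is non-faulty, no faulty processor ever holds a list that it would never
  work off.\<close>

lemma list_time_tasks_gp_state_after:
  assumes "\<not> F 0"
  shows "list_time F (tasks (gp_state_after n F t) i) \<le> list_time F [1..<n] - t"
proof (induction t arbitrary: i)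
  case 0
  show ?case by (simp add: gp_state_after_def gp_init_def)
next
  case (Suc t)
  define s where "s = gp_state_after n F t"
  have step: "gp_state_after n F (Suc t) = gp_round F s"
    by (simp add: gp_state_after_def s_def)
  have IH: "list_time F (tasks s j) \<le> list_time F [1..<n] - t" for j
    using Suc.IH by (simp add: s_def)
  have faulty: "F j \<Longrightarrow> tasks s j = []" for j
    using length_tasks_gp_state_after[of F n t j] assms by (simp add: s_def)
  have bounds:
    "list_time F (even_sublist (tl (tasks s j))) \<le> list_time F [1..<n] - Suc t"
    "list_time F (odd_sublist (tl (tasks s j))) \<le> list_time F [1..<n] - Suc t"
    if "tasks s j \<noteq> []" "\<not> F (hd (tasks s j))" for j
    using that IH[of j] by (cases "tasks s j"; auto)+
  have bound_faulty: "list_time F (tl (tasks s j)) \<le> list_time F [1..<n] - Suc t"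
    if "tasks s j \<noteq> []" "F (hd (tasks s j))" for j
    using that IH[of j] by (cases "tasks s j") auto
  show ?case
  proof (cases "\<not> F i \<and> (\<exists>k. calls F s k i)")
    case True
    \<comment> \<open>The bounds hold for every caller, hence for the one that the choice operator
      picks.\<close>
    define k where "k = (SOME k. calls F s k i)"
    have "calls F s k i"
      using True unfolding k_def by (metis someI_ex)
    then have "tasks s k \<noteq> []" "\<not> F (hd (tasks s k))"
      using True by (simp_all add: calls_def)
    moreover have "tasks (gp_round F s) i = even_sublist (tl (tasks s k))"
      using True by (simp add: gp_round_def k_def)
    ultimately show ?thesis
      unfolding step using bounds(1) by simp
  next
    case False
    then have "tasks (gp_round F s) i = (if \<not> F i \<and> tasks s i \<noteq> [] then
         (if F (hd (tasks s i)) then tl (tasks s i) else odd_sublist (tl (tasks s i)))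
       else tasks s i)"
      by (simp only: gp_round_def gp_state.select_convs if_not_P[OF False] if_False)
    then show ?thesis
      unfolding step using bounds(2)[of i] bound_faulty[of i] faulty[of i]
      by (auto split: if_splits)
  qed
qed

text \<open>After \<open>list_time F [1..<n]\<close> rounds the truncated difference is 0, so every
  list is empty.\<close>

lemma gp_time_le_list_time:
  assumes "\<not> F 0"
  shows "gp_time n F \<le> list_time F [1..<n]"
  unfolding gp_time_def gp_terminated_def
  by (rule Least_le)
     (use list_time_tasks_gp_state_after[of F n "list_time F [1..<n]", OF assms]
       in \<open>simp add: list_time_eq_0_iff\<close>)

section \<open>Dependence of the execution on the statuses below \<open>n\<close>\<close>

lemma tasks_gp_state_after_subset:
  "set (tasks (gp_state_after n F t) i) \<subseteq> {1..<n} \<and>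
    (tasks (gp_state_after n F t) i \<noteq> [] \<longrightarrow> i = 0 \<or> i < n)"
proof (induction t arbitrary: i)
  case 0
  show ?case by (auto simp: gp_state_after_def gp_init_def)
next
  case (Suc t)
  define s where "s = gp_state_after n F t"
  have step: "gp_state_after n F (Suc t) = gp_round F s"
    by (simp add: gp_state_after_def s_def)
  have sub: "set (tasks s j) \<subseteq> {1..<n}" and holder: "tasks s j \<noteq> [] \<Longrightarrow> j = 0 \<or> j < n" for j
    using Suc.IH by (simp_all add: s_def)
  have tl_sub: "set (tl (tasks s j)) \<subseteq> {1..<n}" for j
    using sub[of j] by (cases "tasks s j") auto
  have "set (odd_sublist (tl (tasks s j))) \<subseteq> {1..<n}"
    "set (even_sublist (tl (tasks s j))) \<subseteq> {1..<n}" for j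
    by (rule order_trans[OF set_odd_sublist tl_sub] order_trans[OF set_even_sublist tl_sub])+
  moreover have "i < n" if "\<exists>j. calls F s j i"
  proof -
    from that obtain j where "calls F s j i" ..
    then show ?thesis
      using sub[of j] by (cases "tasks s j") (auto simp: calls_def)
  qed
  ultimately show ?case
    unfolding step using tl_sub sub holder[of i] by (auto simp: gp_round_def split: if_splits)
qed

text \<open>Callers and called processors all lie below \<open>n\<close>, so by induction both runs
  pass through the same states. This serves to make the event of termination by a given round
  measurable.\<close>

lemma gp_time_cong:
  assumes "n \<ge> 1" and eq: "\<And>i. i < n \<Longrightarrow> F i = G i"
  shows "gp_time n F = gp_time n G"
proof -
  have "gp_state_after n F t = gp_state_after n G t" for t
  proof (induction t)
    case (Suc t)
    define s where "s = gp_state_after n F t"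
    have hd_lt: "hd (tasks s i) < n" if "tasks s i \<noteq> []" for i
      using that tasks_gp_state_after_subset[of n F t i] by (cases "tasks s i") (auto simp: s_def)
    have lt: "i < n" if "tasks s i \<noteq> []" for i
      using that tasks_gp_state_after_subset[of n F t i] assms(1) by (force simp: s_def)
    have calls: "calls F s = calls G s"
      using eq lt by (auto simp: calls_def fun_eq_iff)
    have called: "\<not> F j \<and> (\<exists>i. calls G s i j) \<longleftrightarrow> \<not> G j \<and> (\<exists>i. calls G s i j)" for j
      using eq hd_lt by (auto simp: calls_def)
    have holder: "\<not> F j \<and> tasks s j \<noteq> [] \<longleftrightarrow> \<not> G j \<and> tasks s j \<noteq> []" for j
      using eq lt by blast
    have "gp_round F s = gp_round G s"
      unfolding gp_round_def calls called holder
      by (auto simp: fun_eq_iff eq hd_lt)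
    then show ?case
      using Suc.IH by (simp add: gp_state_after_def s_def)
  qed (simp add: gp_state_after_def)
  then show ?thesis
    by (simp add: gp_time_def)
qed

section \<open>Tail bound for the clearing time\<close>

text \<open>Only finitely many status patterns on \<open>A\<close> exist, so the event is a finite
  union of the events that the pattern is exactly a set \<open>S\<close> accepted by
  \<open>Q\<close>.\<close>

lemma pred_finitely_determined:
  fixes X :: "'i \<Rightarrow> 'a \<Rightarrow> bool"
  assumes "finite A" and meas: "\<And>i. i \<in> A \<Longrightarrow> X i \<in> measurable M (count_space UNIV)"
    and cong: "\<And>F G. (\<And>i. i \<in> A \<Longrightarrow> F i = G i) \<Longrightarrow> Q F = Q G"
  shows "Measurable.pred M (\<lambda>\<omega>. Q (\<lambda>i. X i \<omega>))"
proof -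
  have "Q (\<lambda>i. X i \<omega>) \<longleftrightarrow> (\<exists>S\<in>{S \<in> Pow A. Q (\<lambda>i. i \<in> S)}. \<forall>i\<in>A. X i \<omega> = (i \<in> S))" for \<omega>
  proof
    assume "Q (\<lambda>i. X i \<omega>)"
    moreover have "Q (\<lambda>i. X i \<omega>) = Q (\<lambda>i. i \<in> {i \<in> A. X i \<omega>})"
      by (rule cong) simp
    ultimately show "\<exists>S\<in>{S \<in> Pow A. Q (\<lambda>i. i \<in> S)}. \<forall>i\<in>A. X i \<omega> = (i \<in> S)"
      by (intro bexI[of _ "{i \<in> A. X i \<omega>}"]) auto
  next
    assume "\<exists>S\<in>{S \<in> Pow A. Q (\<lambda>i. i \<in> S)}. \<forall>i\<in>A. X i \<omega> = (i \<in> S)"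
    then show "Q (\<lambda>i. X i \<omega>)"
      using cong by (metis (no_types, lifting) mem_Collect_eq)
  qed
  moreover have "Measurable.pred M
      (\<lambda>\<omega>. \<exists>S\<in>{S \<in> Pow A. Q (\<lambda>i. i \<in> S)}. \<forall>i\<in>A. X i \<omega> = (i \<in> S))"
    using \<open>finite A\<close> meas by (intro pred_intros_finite pred_eq_const1) auto
  ultimately show ?thesis
    by simp
qed

lemma pred_list_time:
  assumes "\<And>i. i \<in> set xs \<Longrightarrow> X i \<in> measurable M (count_space UNIV)"
  shows "Measurable.pred M (\<lambda>\<omega>. t < list_time (\<lambda>i. X i \<omega>) xs)"
proof (rule pred_finitely_determined[where A = "set xs" and Q = "\<lambda>F. t < list_time F xs"])
  fix F G :: "nat \<Rightarrow> bool"
  assume "\<And>i. i \<in> set xs \<Longrightarrow> F i = G i"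
  then show "(t < list_time F xs) = (t < list_time G xs)"
    using list_time_cong[of xs F G] by simp
qed (use assms in auto)

text \<open>The blocks \<open>{j}\<close> and \<open>A\<close> of an independent family are
  disjoint, hence independent. This separates the outcome of the first call from the clearing of the
  remaining list.\<close>

lemma (in prob_space) prob_indep_finitely_determined:
  fixes X :: "'i \<Rightarrow> 'a \<Rightarrow> bool"
  assumes ind: "indep_vars (\<lambda>_. count_space UNIV) X I"
    and A: "finite A" "A \<subseteq> I" "j \<in> I" "j \<notin> A"
    and cong: "\<And>F G. (\<And>i. i \<in> A \<Longrightarrow> F i = G i) \<Longrightarrow> Q F = Q G"
  shows "prob {\<omega> \<in> space M. X j \<omega> = b \<and> Q (\<lambda>i. X i \<omega>)} =
    prob {\<omega> \<in> space M. X j \<omega> = b} * prob {\<omega> \<in> space M. Q (\<lambda>i. X i \<omega>)}"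
proof -
  let ?C = "\<lambda>_::'i. count_space (UNIV :: bool set)"
  have "indep_var (PiM {j} ?C) (\<lambda>\<omega>. restrict (\<lambda>i. X i \<omega>) {j})
      (PiM A ?C) (\<lambda>\<omega>. restrict (\<lambda>i. X i \<omega>) A)"
    using A by (intro indep_var_restrict[OF ind]) auto
  moreover have "(\<lambda>f. f j) \<in> measurable (PiM {j} ?C) (count_space UNIV)"
    by (rule measurable_component_singleton) simp
  moreover have "Measurable.pred (PiM A ?C) (\<lambda>f. Q (\<lambda>i. f i))"
    by (rule pred_finitely_determined[OF \<open>finite A\<close> _ cong]) (rule measurable_component_singleton)
  ultimately have "indep_var (count_space UNIV) ((\<lambda>f. f j) \<circ> (\<lambda>\<omega>. restrict (\<lambda>i. X i \<omega>) {j}))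
      (count_space UNIV) ((\<lambda>f. Q (\<lambda>i. f i)) \<circ> (\<lambda>\<omega>. restrict (\<lambda>i. X i \<omega>) A))"
    by (rule indep_var_compose)
  from indep_varD[OF this, of "{b}" "{True}"] have
    "prob {\<omega> \<in> space M. X j \<omega> = b \<and> Q (restrict (\<lambda>i. X i \<omega>) A)} =
      prob {\<omega> \<in> space M. X j \<omega> = b} * prob {\<omega> \<in> space M. Q (restrict (\<lambda>i. X i \<omega>) A)}"
    by (simp add: vimage_def Int_def conj_ac)
  \<comment> \<open>Outside \<open>A\<close> the restriction is \<open>undefined\<close>, which
    \<open>Q\<close> does not see.\<close>
  moreover have "Q (restrict (\<lambda>i. X i \<omega>) A) = Q (\<lambda>i. X i \<omega>)" for \<omega>
    by (rule cong) simp
  ultimately show ?thesis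
    by simp
qed

text \<open>The exponent \<open>d\<close> varies with \<open>L\<close> in the induction: a faulty
  head keeps it, a successful call lowers it by one.\<close>

lemma (in prob_space) prob_list_time_greater:
  fixes X :: "nat \<Rightarrow> 'a \<Rightarrow> bool" and c p :: real
  assumes ind: "indep_vars (\<lambda>_. count_space UNIV) X I"
    and pr: "\<And>i. i \<in> I \<Longrightarrow> prob {\<omega> \<in> space M. X i \<omega>} = 1 - p"
    and p: "0 \<le> p" "p \<le> 1" and c: "1 \<le> c"
  shows "distinct L \<Longrightarrow> set L \<subseteq> I \<Longrightarrow> length L < 2 ^ Suc d \<Longrightarrow>
    prob {\<omega> \<in> space M. t < list_time (\<lambda>i. X i \<omega>) L} \<le> length L * c ^ d * (1 - p + p / c) ^ t"
proof (induction t arbitrary: L d)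
  case 0
  show ?case
  proof (cases "L = []")
    case False
    \<comment> \<open>For \<open>t = 0\<close> and a nonempty list the bound is at least 1, hence
      trivial.\<close>
    then have "1 * 1 \<le> real (length L) * c ^ d"
      using c by (intro mult_mono) (auto simp: Suc_le_eq)
    then show ?thesis
      by (auto intro: order_trans[OF prob_le_1])
  qed simp
next
  case (Suc t)
  let ?T = "\<lambda>xs \<omega>. list_time (\<lambda>i. X i \<omega>) xs"
  let ?q = "1 - p + p / c"
  have q: "0 \<le> ?q"
    using p c by simp
  have meas[measurable]: "X i \<in> measurable M (count_space UNIV)" if "i \<in> I" for i
    using ind that by (auto simp: indep_vars_def)
  \<comment> \<open>\<open>d = 0\<close> forces length at most 1, and such a list is cleared within
    one round; otherwise \<open>d\<close> can be lowered.\<close>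
  consider (short) "length L \<le> 1" | (long) j js d' where "L = j # js" "d = Suc d'"
    using Suc.prems by (cases L; cases d) auto
  then show ?case
  proof cases
    case short
    then have "\<not> Suc t < ?T L \<omega>" for \<omega>
      by (cases L) auto
    then show ?thesis
      using q c by simp
  next
    case long
    note L = \<open>L = j # js\<close>
    let ?E = "\<lambda>b xs. {\<omega> \<in> space M. X j \<omega> = b \<and> t < ?T xs \<omega>}"
    have jI: "j \<in> I" and js: "distinct js" "set js \<subseteq> I" "j \<notin> set js"
      using Suc.prems L by auto
    have split: "prob (?E b xs) = prob {\<omega> \<in> space M. X j \<omega> = b} * prob {\<omega> \<in> space M. t < ?T xs \<omega>}"
      if "set xs \<subseteq> set js" for b xs
    proof (rule prob_indep_finitely_determined[OF ind, where A = "set xs"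
          and Q = "\<lambda>F. t < list_time F xs"])
      fix F G :: "nat \<Rightarrow> bool"
      assume "\<And>i. i \<in> set xs \<Longrightarrow> F i = G i"
      then show "(t < list_time F xs) = (t < list_time G xs)"
        using list_time_cong[of xs F G] by simp
    qed (use that jI js in auto)
    have ev: "?E b xs \<in> events" if "set xs \<subseteq> set js" for b xs
    proof -
      have "Measurable.pred M (\<lambda>\<omega>. t < ?T xs \<omega>)"
        by (rule pred_list_time) (use that js meas in auto)
      then show ?thesis
        using jI by measurable
    qed
    note sub = set_odd_sublist[of js] set_even_sublist[of js]
    have pT: "prob {\<omega> \<in> space M. X j \<omega> = True} = 1 - p"
      using pr[OF jI] by simp
    have "{\<omega> \<in> space M. X j \<omega>} \<in> events"
      using jI by measurable
    from prob_neg[OF this] have pF: "prob {\<omega> \<in> space M. X j \<omega> = False} = p"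
      using pr[OF jI] by simp
    \<comment> \<open>Removing the head offsets the rounding up in the odd half: its length is
      \<open>length L div 2\<close>.\<close>
    have len: "length js < 2 ^ Suc d" "length (odd_sublist js) < 2 ^ Suc d'"
      "length (even_sublist js) < 2 ^ Suc d'"
      using Suc.prems(3) long by (auto simp: length_odd_sublist length_even_sublist)
    \<comment> \<open>Since the lengths add up exactly, the union bound over the halves costs no
      factor 2.\<close>
    have halves: "real (length js) = real (length (odd_sublist js)) + real (length (even_sublist js))"
      unfolding length_odd_sublist length_even_sublist of_nat_add[symmetric] of_nat_eq_iff
      by presburger
    have "{\<omega> \<in> space M. Suc t < ?T L \<omega>} \<subseteq>
        ?E True js \<union> (?E False (odd_sublist js) \<union> ?E False (even_sublist js))"
      unfolding L by (auto split: if_splits)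
    then have "prob {\<omega> \<in> space M. Suc t < ?T L \<omega>} \<le>
        prob (?E True js \<union> (?E False (odd_sublist js) \<union> ?E False (even_sublist js)))"
      by (rule finite_measure_mono) (intro sets.Un ev sub order_refl)
    also have "\<dots> \<le> prob (?E True js) + (prob (?E False (odd_sublist js)) + prob (?E False (even_sublist js)))"
      by (intro order_trans[OF measure_Un_le] add_left_mono sets.Un ev sub order_refl)
    also have "\<dots> = (1 - p) * prob {\<omega> \<in> space M. t < ?T js \<omega>} +
        (p * prob {\<omega> \<in> space M. t < ?T (odd_sublist js) \<omega>} +
         p * prob {\<omega> \<in> space M. t < ?T (even_sublist js) \<omega>})"
      by (simp only: split[OF order_refl] split[OF sub(1)] split[OF sub(2)] pT pF)
    also have "\<dots> \<le> (1 - p) * (length js * c ^ d * ?q ^ t) +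
        (p * (length (odd_sublist js) * c ^ d' * ?q ^ t) +
         p * (length (even_sublist js) * c ^ d' * ?q ^ t))"
      using p js sub len
      by (intro add_mono mult_left_mono Suc.IH distinct_odd_even_sublist[THEN conjunct1]
          distinct_odd_even_sublist[THEN conjunct2]) auto
    \<comment> \<open>Writing \<open>c ^ d'\<close> as \<open>c ^ d / c\<close> turns the weight
      \<open>p\<close> into \<open>p / c\<close>, which completes the factor
      \<open>?q\<close>.\<close>
    also have "\<dots> = length js * c ^ d * ?q ^ Suc t"
      unfolding halves long(2) using c by (simp add: field_simps)
    also have "\<dots> \<le> length L * c ^ d * ?q ^ Suc t"
      using c q by (intro mult_right_mono) (auto simp: L)
    finally show ?thesis .
  qed
qed

section \<open>The Chernoff exponent\<close>

text \<open>The difference of the two sides vanishes at 1 and has the derivative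
  \<open>(1 - 1 / y)\<^sup>2 / 2\<close>.\<close>

lemma ln_le_half_diff_inverse:
  fixes x :: real
  assumes "1 \<le> x"
  shows "ln x \<le> (x - 1 / x) / 2"
proof -
  let ?g = "\<lambda>x::real. (x - 1 / x) / 2 - ln x"
  have "?g 1 \<le> ?g x"
  proof (rule DERIV_nonneg_imp_nondecreasing[OF assms])
    fix y :: real
    assume "1 \<le> y"
    then have "(?g has_real_derivative (1 - 1 / y)\<^sup>2 / 2) (at y)"
      by (auto intro!: derivative_eq_intros simp: power2_eq_square field_simps)
    then show "\<exists>D. (?g has_real_derivative D) (at y) \<and> 0 \<le> D"
      by (meson divide_nonneg_nonneg zero_le_numeral zero_le_power2)
  qed
  then show ?thesis
    by simp
qed

text \<open>By \<open>1 + x \<le> exp x\<close> and the hypothesis on \<open>t\<close>, the power is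
  at most \<open>exp (- (k * (c - 1)))\<close>. With \<open>c ^ k = exp (k * ln c)\<close> the bound
  on \<open>ln c\<close> leaves exactly the stated exponent.\<close>

lemma chernoff_exponent_bound:
  fixes c p :: real
  assumes "1 < c" "0 < p" "p \<le> 1" and t: "c * real k \<le> p * real t"
  shows "c ^ k * (1 - p + p / c) ^ t \<le> exp (- ((c - 1)\<^sup>2 / (2 * c) * real k))"
proof -
  have "1 - p + p / c = 1 + - (p * (1 - 1 / c))"
    using assms by (simp add: field_simps)
  also have "\<dots> \<le> exp (- (p * (1 - 1 / c)))"
    by (rule exp_ge_add_one_self)
  finally have "(1 - p + p / c) ^ t \<le> exp (- (p * (1 - 1 / c))) ^ t"
    using assms by (intro power_mono) auto
  also have "\<dots> = exp (- ((p * real t) * (1 - 1 / c)))"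
    by (simp add: exp_of_nat_mult[symmetric] mult_ac)
  also have "\<dots> \<le> exp (- ((c * real k) * (1 - 1 / c)))"
    using assms by (intro exp_le_cancel_iff[THEN iffD2] le_imp_neg_le mult_right_mono t) auto
  also have "(c * real k) * (1 - 1 / c) = real k * (c - 1)"
    using assms by (simp add: field_simps)
  finally have "c ^ k * (1 - p + p / c) ^ t \<le> c ^ k * exp (- (real k * (c - 1)))"
    using assms by (intro mult_left_mono) auto
  also have "\<dots> = exp (real k * ln c) * exp (- (real k * (c - 1)))"
    using assms by (simp add: exp_of_nat_mult)
  also have "\<dots> = exp (real k * (ln c - (c - 1)))"
    by (simp add: exp_add[symmetric] right_diff_distrib)
  also have "\<dots> \<le> exp (real k * ((c - 1 / c) / 2 - (c - 1)))"
    using ln_le_half_diff_inverse[of c] assms by (simp add: mult_left_mono)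
  also have "(c - 1 / c) / 2 - (c - 1) = - ((c - 1)\<^sup>2 / (2 * c))"
    using assms by (simp add: field_simps power2_eq_square)
  finally show ?thesis
    by (simp add: mult_ac)
qed

section \<open>The bound on the execution time\<close>

theorem theorem9:
  fixes M :: "'a measure" and faulty :: "nat \<Rightarrow> 'a \<Rightarrow> bool" and n :: nat and c p :: real
  assumes "prob_space M"
    and "n \<ge> 2"
    and "c > 1"
    and "0 < p" and "p < 1"
    and "\<And>\<omega>. \<omega> \<in> space M \<Longrightarrow> \<not> faulty 0 \<omega>"
    and "prob_space.indep_vars M (\<lambda>_. count_space UNIV) faulty {1..<n}"
    and "\<And>i. i \<in> {1..<n} \<Longrightarrow> measure M {\<omega> \<in> space M. faulty i \<omega>} = 1 - p"
  shows "measure M {\<omega> \<in> space M.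
           real (gp_time n (\<lambda>i. faulty i \<omega>)) \<le> c / p * (of_int \<lceil>log 2 (real n - 1)\<rceil> + 1)}
         \<ge> 1 - real n * exp (- ((c - 1)\<^sup>2 / (2 * c) * (of_int \<lceil>log 2 (real n - 1)\<rceil> - 1)))"
proof -
  interpret prob_space M by fact
  define k where "k = nat \<lceil>log 2 (real n - 1)\<rceil>"
  have "0 \<le> log 2 (real n - 1)"
    using \<open>n \<ge> 2\<close> by simp
  then have k: "of_int \<lceil>log 2 (real n - 1)\<rceil> = real k"
    by (simp add: k_def)
  have "log 2 (real n - 1) \<le> real k"
    using le_of_int_ceiling[of "log 2 (real n - 1)"] unfolding k .
  then have "real n - 1 \<le> 2 ^ k"
    using \<open>n \<ge> 2\<close> by (simp add: log_le_iff powr_realpow)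
  \<comment> \<open>From \<open>n - 1 \<le> 2 ^ k\<close> the tail bound applies with
    \<open>d = k\<close>.\<close>
  then have "real (n - 1) < real (2 ^ Suc k)"
    using \<open>n \<ge> 2\<close> zero_less_power[of "2::real" k] by (simp add: of_nat_diff)
  then have len: "length [1..<n] < 2 ^ Suc k"
    by (simp only: of_nat_less_iff length_upt)
  define B where "B = c / p * (real k + 1)"
  \<comment> \<open>Execution times are integers, so comparing with \<open>B\<close> or with its
    integer part is the same.\<close>
  define t where "t = nat \<lfloor>B\<rfloor>"
  have "0 \<le> B"
    using assms by (simp add: B_def)
  then have le_B: "real m \<le> B \<longleftrightarrow> m \<le> t" for m
    by (simp add: t_def le_nat_floor nat_le_iff le_floor_iff le_nat_iff)
  have "B - 1 \<le> real t"
    using \<open>0 \<le> B\<close> by (simp add: t_def)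
  then have "p * (B - 1) \<le> p * real t"
    using assms by (intro mult_left_mono) auto
  \<comment> \<open>The summand 1 in \<open>real k + 1\<close> pays for rounding \<open>B\<close>
    down, because \<open>p < c\<close>.\<close>
  moreover have "p * (B - 1) = c * real k + (c - p)"
    using assms by (simp add: B_def field_simps)
  ultimately have t: "c * real k \<le> p * real t"
    using assms by simp
  let ?T = "\<lambda>\<omega>. list_time (\<lambda>i. faulty i \<omega>) [1..<n]"
  let ?r = "(c - 1)\<^sup>2 / (2 * c)"
  have meas: "faulty i \<in> measurable M (count_space UNIV)" if "i \<in> {1..<n}" for i
    using assms(7) that by (auto simp: indep_vars_def)
  have "prob {\<omega> \<in> space M. t < ?T \<omega>} \<le> real (n - 1) * (c ^ k * (1 - p + p / c) ^ t)"
    using prob_list_time_greater[OF assms(7,8), of c "[1..<n]" k t] len assms by (simp add: mult_ac)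
  also have "\<dots> \<le> real n * exp (- (?r * real k))"
    using assms by (intro mult_mono[OF _ chernoff_exponent_bound] t) auto
  \<comment> \<open>The exponent is weakened from \<open>k\<close> to \<open>k - 1\<close> to match
    the claim.\<close>
  also have "\<dots> \<le> real n * exp (- (?r * (real k - 1)))"
    using assms by (intro mult_left_mono exp_le_cancel_iff[THEN iffD2] le_imp_neg_le) auto
  finally have tail: "prob {\<omega> \<in> space M. t < ?T \<omega>} \<le> real n * exp (- (?r * (real k - 1)))" .
  have pred_T: "Measurable.pred M (\<lambda>\<omega>. t < ?T \<omega>)"
    by (rule pred_list_time) (use meas in auto)
  \<comment> \<open>Monotonicity of \<open>prob\<close> requires the larger event to be measurable.
    Measurability is given for the indices in \<open>{1..<n}\<close>, so index 0 is masked; on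
    \<open>space M\<close> this changes nothing, as processor 0 is never faulty there.\<close>
  have "Measurable.pred M (\<lambda>\<omega>. gp_time n (\<lambda>i. i \<noteq> 0 \<and> faulty i \<omega>) \<le> t)"
  proof (rule pred_finitely_determined[where A = "{1..<n}" and X = faulty
        and Q = "\<lambda>F. gp_time n (\<lambda>i. i \<noteq> 0 \<and> F i) \<le> t"])
    fix F G :: "nat \<Rightarrow> bool"
    assume "\<And>i. i \<in> {1..<n} \<Longrightarrow> F i = G i"
    then have "gp_time n (\<lambda>i. i \<noteq> 0 \<and> F i) = gp_time n (\<lambda>i. i \<noteq> 0 \<and> G i)"
      using \<open>n \<ge> 2\<close> by (intro gp_time_cong) (auto simp: Suc_le_eq)
    then show "(gp_time n (\<lambda>i. i \<noteq> 0 \<and> F i) \<le> t) = (gp_time n (\<lambda>i. i \<noteq> 0 \<and> G i) \<le> t)"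
      by simp
  qed (use meas in auto)
  moreover have "(\<lambda>i. i \<noteq> 0 \<and> faulty i \<omega>) = (\<lambda>i. faulty i \<omega>)" if "\<omega> \<in> space M" for \<omega>
    using assms(6)[OF that] by (auto simp: fun_eq_iff intro: gr0I)
  ultimately have ev: "{\<omega> \<in> space M. gp_time n (\<lambda>i. faulty i \<omega>) \<le> t} \<in> events"
    by (simp add: pred_def cong: conj_cong)
  have "1 - prob {\<omega> \<in> space M. t < ?T \<omega>} = prob (space M - {\<omega> \<in> space M. t < ?T \<omega>})"
    using pred_T by (simp add: prob_compl pred_def)
  also have "\<dots> \<le> prob {\<omega> \<in> space M. gp_time n (\<lambda>i. faulty i \<omega>) \<le> t}"
    using gp_time_le_list_time[of "\<lambda>i. faulty i \<omega>" n for \<omega>] assms(6)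
    by (intro finite_measure_mono ev) (force intro: order_trans)
  finally show ?thesis
    using tail unfolding k B_def[symmetric] le_B by linarith
qed

end
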